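(* Let $\Delta$ be the root system of type $H(a,b)$ with $a>4$ and $b=1$, and let $\beta\in\Delta^{\mathrm{re}}_+$ be a positive real root. Then: (i) $\beta+\alpha_1\in\Delta^{\mathrm{re}}$ if and only if $\beta=\alpha_2$; (ii) $\beta-\alpha_1\in\Delta^{\mathrm{re}}$ if and only if $\beta=\alpha_1+\alpha_2$; (iii) $\beta+\alpha_2\in\Delta^{\mathrm{re}}$ if and only if $\beta=\alpha_1$ or $\beta=\alpha_1+(a-1)\alpha_2$; (iv) $\beta-\alpha_2\in\Delta^{\mathrm{re}}$ if and only if $\beta=\alpha_1+\alpha_2$ or $\beta=\alpha_1+a\alpha_2$.
   Context: The root system of type $H(a,b)$ is that of the Kac--Moody algebra with generalized Cartan matrix $\begin{pmatrix}2&-b\\-a&2\end{pmatrix}$ ($a,b$ positive integers). Simple roots are $\alpha_1,\alpha_2$ (linearly independent); simple reflections $w_1(\alpha_1)=-\alpha_1$, $w_1(\alpha_2)=\alpha_2+b\alpha_1$, $w_2(\alpha_1)=\alpha_1+a\alpha_2$, $w_2(\alpha_2)=-\alpha_2$; Weyl group $W=\langle w_1,w_2\rangle$; real roots $\Delta^{\mathrm{re}}=W\alpha_1\cup W\alpha_2$. A real root is positive if its coefficients in $\alpha_1,\alpha_2$ are all $\ge0$; $\Delta^{\mathrm{re}}_+$ is the set of positive real roots. *)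

theory Defs
  imports "HOL-Analysis.Product_Vector" "HOL-Algebra.Bij" "HOL-Algebra.Generated_Groups"
begin

text \<open>
  The ambient space is the real span of the two simple roots; the pair \<open>(x, y)\<close> stands for
  \<open>x \<alpha>\<^sub>1 + y \<alpha>\<^sub>2\<close>.
\<close>

definition alpha1 :: "real \<times> real" where "alpha1 = (1, 0)"
definition alpha2 :: "real \<times> real" where "alpha2 = (0, 1)"

text \<open>
  For \<open>H(a,b)\<close> the simple reflections are the linear maps with
  \<open>w\<^sub>1 \<alpha>\<^sub>2 = \<alpha>\<^sub>2 + b \<alpha>\<^sub>1\<close> and \<open>w\<^sub>2 \<alpha>\<^sub>1 = \<alpha>\<^sub>1 + a \<alpha>\<^sub>2\<close>, negating
  their own simple root; the lemmas below check that these formulas are those maps.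
\<close>

definition w1 :: "nat \<Rightarrow> real \<times> real \<Rightarrow> real \<times> real" where
  "w1 b v = (real b * snd v - fst v, snd v)"

definition w2 :: "nat \<Rightarrow> real \<times> real \<Rightarrow> real \<times> real" where
  "w2 a v = (fst v, real a * fst v - snd v)"

definition weyl_group :: "nat \<Rightarrow> nat \<Rightarrow> (real \<times> real \<Rightarrow> real \<times> real) set" where
  "weyl_group a b = generate (BijGroup UNIV) {w1 b, w2 a}"

definition real_roots :: "nat \<Rightarrow> nat \<Rightarrow> (real \<times> real) set" where
  "real_roots a b = (\<lambda>w. w alpha1) ` weyl_group a b \<union> (\<lambda>w. w alpha2) ` weyl_group a b"

definition pos_real_roots :: "nat \<Rightarrow> nat \<Rightarrow> (real \<times> real) set" where
  "pos_real_roots a b = {\<beta> \<in> real_roots a b. fst \<beta> \<ge> 0 \<and> snd \<beta> \<ge> 0}"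

lemma coordinates: "v = fst v *\<^sub>R alpha1 + snd v *\<^sub>R alpha2"
  by (simp add: alpha1_def alpha2_def prod_eq_iff)

lemma linear_w1: "linear (w1 b)"
  by (rule linearI) (auto simp: w1_def prod_eq_iff algebra_simps)

lemma linear_w2: "linear (w2 a)"
  by (rule linearI) (auto simp: w2_def prod_eq_iff algebra_simps)

lemma w1_simple_roots:
  "w1 b alpha1 = - alpha1"
  "w1 b alpha2 = alpha2 + real b *\<^sub>R alpha1"
  by (simp_all add: w1_def alpha1_def alpha2_def)

lemma w2_simple_roots:
  "w2 a alpha1 = alpha1 + real a *\<^sub>R alpha2"
  "w2 a alpha2 = - alpha2"
  by (simp_all add: w2_def alpha1_def alpha2_def)

text \<open>The generators do lie in the ambient group, as required for \<^const>\<open>generate\<close>.\<close>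

lemma w1_in_BijGroup: "w1 b \<in> carrier (BijGroup UNIV)"
proof -
  have "w1 b (w1 b v) = v" for v by (simp add: w1_def)
  then have "bij (w1 b)" by (rule involuntory_imp_bij)
  then show ?thesis by (simp add: BijGroup_def Bij_def)
qed

lemma w2_in_BijGroup: "w2 a \<in> carrier (BijGroup UNIV)"
proof -
  have "w2 a (w2 a v) = v" for v by (simp add: w2_def)
  then have "bij (w2 a)" by (rule involuntory_imp_bij)
  then show ?thesis by (simp add: BijGroup_def Bij_def)
qed

end

theory Submission
  imports Defs
begin

text \<open>
  The Weyl group preserves the lattice of integral vectors and the quadratic form
  \<open>q(x, y) = a x\<^sup>2 - a b x y + b y\<^sup>2\<close>, whose values at \<open>\<alpha>\<^sub>1\<close> and \<open>\<alpha>\<^sub>2\<close> are \<open>a\<close> and \<open>b\<close>.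
  So for \<open>b = 1\<close> every real root is an integral vector with \<open>q \<in> {1, a}\<close>.

  If \<open>\<gamma>\<close> and \<open>\<gamma> + \<alpha>\<^sub>i\<close> are both roots, then the difference of their \<open>q\<close>-values, which is an
  affine function of \<open>\<gamma>\<close>, lies in \<open>{0, a - 1, 1 - a}\<close>. Each of these values confines \<open>\<gamma>\<close> to a
  line, and on that line the equation for \<open>q \<gamma>\<close> is quadratic in one variable, with
  leading coefficient a negative multiple of \<open>a - 4\<close>. For \<open>a > 4\<close> it therefore leaves at most two
  points on each line (\<open>root_string_alpha1\<close>, \<open>root_string_alpha2\<close>). This one
  analysis settles addition, with \<open>\<gamma> = \<beta>\<close>, and subtraction, with \<open>\<gamma> = \<beta> - \<alpha>\<^sub>i\<close>; positivity of
  \<open>\<beta>\<close> then rules out the solutions that are negative roots. Conversely the vectors named in the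
  theorem are reached from simple roots by at most two simple reflections.
\<close>

definition weyl_form :: "nat \<Rightarrow> nat \<Rightarrow> real \<times> real \<Rightarrow> real" where
  "weyl_form a b v = real a * (fst v)\<^sup>2 - real a * real b * fst v * snd v + real b * (snd v)\<^sup>2"

definition integral_level :: "nat \<Rightarrow> nat \<Rightarrow> real \<Rightarrow> (real \<times> real) set" where
  "integral_level a b c = {v. fst v \<in> \<int> \<and> snd v \<in> \<int> \<and> weyl_form a b v = c}"

lemma simple_reflection_preserves_integral_level:
  "h \<in> {w1 b, w2 a} \<Longrightarrow> v \<in> integral_level a b c \<Longrightarrow> h v \<in> integral_level a b c"
  by (auto simp: integral_level_def weyl_form_def w1_def w2_def algebra_simps power2_eq_square)

lemma BijGroup_UNIV_mult:
  "f \<in> carrier (BijGroup UNIV) \<Longrightarrow> g \<in> carrier (BijGroup UNIV) \<Longrightarrow>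
     f \<otimes>\<^bsub>BijGroup UNIV\<^esub> g = f \<circ> g"
  by (auto simp: BijGroup_def compose_def)

lemma BijGroup_UNIV_one: "\<one>\<^bsub>BijGroup UNIV\<^esub> = id"
  by (auto simp: BijGroup_def)

lemma inv_simple_reflection:
  assumes "h \<in> {w1 b, w2 a}"
  shows "inv\<^bsub>BijGroup UNIV\<^esub> h = h"
proof (rule group.inv_equality[OF group_BijGroup])
  show h: "h \<in> carrier (BijGroup UNIV)"
    using assms w1_in_BijGroup w2_in_BijGroup by auto
  then show "h \<in> carrier (BijGroup UNIV)" .
  have "h \<circ> h = id"
    using assms by (auto simp: fun_eq_iff w1_def w2_def)
  then show "h \<otimes>\<^bsub>BijGroup UNIV\<^esub> h = \<one>\<^bsub>BijGroup UNIV\<^esub>"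
    using h by (simp add: BijGroup_UNIV_mult BijGroup_UNIV_one)
qed

lemma weyl_group_carrier: "weyl_group a b \<subseteq> carrier (BijGroup UNIV)"
  unfolding weyl_group_def
  by (rule group.generate_incl[OF group_BijGroup]) (auto simp: w1_in_BijGroup w2_in_BijGroup)

lemma weyl_group_comp:
  assumes "f \<in> weyl_group a b" and "g \<in> weyl_group a b"
  shows "f \<circ> g \<in> weyl_group a b"
  using generate.eng[of f "BijGroup UNIV" "{w1 b, w2 a}" g] assms weyl_group_carrier[of a b]
  by (auto simp: weyl_group_def BijGroup_UNIV_mult subset_iff)

lemma weyl_group_preserves_integral_level:
  assumes "w \<in> weyl_group a b"
  shows "v \<in> integral_level a b c \<Longrightarrow> w v \<in> integral_level a b c"
  using assms unfolding weyl_group_def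
proof (induction arbitrary: v rule: generate.induct)
  case one
  then show ?case by (simp add: BijGroup_UNIV_one)
next
  case (incl h)
  then show ?case by (rule simple_reflection_preserves_integral_level)
next
  case (inv h)
  then show ?case
    using simple_reflection_preserves_integral_level[OF inv.hyps]
    by (simp only: inv_simple_reflection[OF inv.hyps])
next
  case (eng f g)
  then show ?case
    using weyl_group_carrier[of a b]
    by (simp add: weyl_group_def BijGroup_UNIV_mult subset_iff)
qed

lemma real_roots_subset_integral_level:
  "real_roots a b \<subseteq> integral_level a b (real a) \<union> integral_level a b (real b)"
proof -
  have "alpha1 \<in> integral_level a b (real a)" "alpha2 \<in> integral_level a b (real b)"
    by (auto simp: integral_level_def weyl_form_def alpha1_def alpha2_def)
  then show ?thesis
    unfolding real_roots_def using weyl_group_preserves_integral_level by blast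
qed

lemma simple_roots_in_real_roots:
  "alpha1 \<in> real_roots a b" "alpha2 \<in> real_roots a b"
proof -
  have "id \<in> weyl_group a b"
    using generate.one[of "BijGroup UNIV"] by (simp add: weyl_group_def BijGroup_UNIV_one)
  then show "alpha1 \<in> real_roots a b" "alpha2 \<in> real_roots a b"
    unfolding real_roots_def by (metis UnI1 UnI2 id_apply image_eqI)+
qed

lemma real_roots_closed:
  assumes "w \<in> weyl_group a b" and "v \<in> real_roots a b"
  shows "w v \<in> real_roots a b"
  using assms(2) weyl_group_comp[OF assms(1)] unfolding real_roots_def
  by (auto simp: image_iff) (metis comp_apply)+

lemma simple_reflections_in_weyl_group:
  "w1 b \<in> weyl_group a b" "w2 a \<in> weyl_group a b"
  by (auto simp: weyl_group_def intro: generate.incl)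

text \<open>
  The value \<open>q(\<gamma> + \<alpha>\<^sub>1) - q \<gamma>\<close> is a multiple of \<open>a\<close>, which \<open>a - 1\<close> is not, so \<open>\<gamma>\<close> and \<open>\<gamma> + \<alpha>\<^sub>1\<close> have the same
  length. This puts \<open>\<gamma>\<close> on the line \<open>y = 2 x + 1\<close>, where \<open>q = 1 - (a - 4) x (x + 1)\<close>; for
  integral \<open>x\<close> this is at most \<open>1\<close>, with equality only at \<open>x = 0\<close> and \<open>x = - 1\<close>.
\<close>

lemma root_string_alpha1:
  assumes a: "a > 4"
    and root: "(x, y) \<in> real_roots a 1" and root': "(x, y) + alpha1 \<in> real_roots a 1"
  shows "(x, y) = (0, 1) \<or> (x, y) = (- 1, - 1)"
proof -
  obtain m n :: int where mn: "x = of_int m" "y = of_int n"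
    and q_real: "weyl_form a 1 (x, y) \<in> {real a, 1}"
    using subsetD[OF real_roots_subset_integral_level root]
    by (auto simp: integral_level_def elim!: Ints_cases)
  have q_real': "weyl_form a 1 (x + 1, y) \<in> {real a, 1}"
    using subsetD[OF real_roots_subset_integral_level root']
    by (auto simp: integral_level_def alpha1_def)
  define A where "A = int a"
  have A: "A > 4" using a by (simp add: A_def)
  have rA: "real a = of_int A" by (simp add: A_def)
  have q: "A * m\<^sup>2 - A * m * n + n\<^sup>2 \<in> {A, 1}"
  proof -
    have "real_of_int (A * m\<^sup>2 - A * m * n + n\<^sup>2) \<in> {of_int A, of_int 1}"
      using q_real by (simp add: weyl_form_def mn rA)
    then show ?thesis unfolding insert_iff empty_iff of_int_eq_iff .
  qed
  have q': "A * (m + 1)\<^sup>2 - A * (m + 1) * n + n\<^sup>2 \<in> {A, 1}"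
  proof -
    have "real_of_int (A * (m + 1)\<^sup>2 - A * (m + 1) * n + n\<^sup>2) \<in> {of_int A, of_int 1}"
      using q_real' by (simp add: weyl_form_def mn rA)
    then show ?thesis unfolding insert_iff empty_iff of_int_eq_iff .
  qed
  have diff: "A * (m + 1)\<^sup>2 - A * (m + 1) * n + n\<^sup>2 - (A * m\<^sup>2 - A * m * n + n\<^sup>2)
      = A * (2 * m + 1 - n)"
    by (simp add: algebra_simps power2_eq_square)
  have "A * (2 * m + 1 - n) \<in> {0, A - 1, 1 - A}"
    using q q' unfolding diff[symmetric] by auto
  moreover have "A * k \<noteq> A - 1" "A * k \<noteq> 1 - A" for k
  proof -
    have "\<not> A dvd 1" using A by auto
    then have "\<not> A dvd A - 1" "\<not> A dvd 1 - A"
      by (simp_all add: dvd_diff_right_iff dvd_diff_left_iff)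
    then show "A * k \<noteq> A - 1" "A * k \<noteq> 1 - A" by (metis dvd_triv_left)+
  qed
  ultimately have "A * (2 * m + 1 - n) = 0" by blast
  then have n: "n = 2 * m + 1" using A by simp
  have q_line: "1 - (A - 4) * (m * (m + 1)) \<in> {A, 1}"
    using q by (simp add: n algebra_simps power2_eq_square)
  have "m * (m + 1) \<ge> 0"
    by (cases "m \<ge> 0") (auto intro: mult_nonneg_nonneg mult_nonpos_nonpos)
  then have "(A - 4) * (m * (m + 1)) \<ge> 0" using A by simp
  then have "(A - 4) * (m * (m + 1)) = 0" using q_line A by auto
  then have "m = 0 \<or> m = - 1" using A by auto
  then show ?thesis using mn n by auto
qed

text \<open>
  Since \<open>q(\<gamma> + \<alpha>\<^sub>2) - q \<gamma> = 2 y - a x + 1\<close>, the two lengths determine \<open>2 y - a x\<close>, and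
  completing the square gives \<open>4 q = (2 y - a x)\<^sup>2 - a (a - 4) x\<^sup>2\<close>.
  Equal lengths give \<open>2 y - a x = - 1\<close> and the contradiction \<open>4 q \<le> 1\<close>; a short \<open>\<gamma>\<close> with a long
  \<open>\<gamma> + \<alpha>\<^sub>2\<close>, or conversely, gives \<open>x\<^sup>2 = 1\<close>.
\<close>

lemma root_string_alpha2:
  assumes a: "a > 4"
    and root: "(x, y) \<in> real_roots a 1" and root': "(x, y) + alpha2 \<in> real_roots a 1"
  shows "(x, y) \<in> {(1, 0), (- 1, - real a), (1, real a - 1), (- 1, - 1)}"
proof -
  define A where "A = real a"
  have A: "A > 4" using a by (simp add: A_def)
  have q: "A * x\<^sup>2 - A * x * y + y\<^sup>2 \<in> {A, 1}"
    using subsetD[OF real_roots_subset_integral_level root]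
    by (auto simp: integral_level_def weyl_form_def A_def)
  have q': "A * x\<^sup>2 - A * x * (y + 1) + (y + 1)\<^sup>2 \<in> {A, 1}"
    using subsetD[OF real_roots_subset_integral_level root']
    by (auto simp: integral_level_def weyl_form_def alpha2_def A_def)
  have square: "4 * (A * x\<^sup>2 - A * x * y + y\<^sup>2) = (2 * y - A * x)\<^sup>2 - A * (A - 4) * x\<^sup>2"
    by (simp add: algebra_simps power2_eq_square)
  have diff: "A * x\<^sup>2 - A * x * (y + 1) + (y + 1)\<^sup>2 - (A * x\<^sup>2 - A * x * y + y\<^sup>2)
      = 2 * y - A * x + 1"
    by (simp add: algebra_simps power2_eq_square)
  have unit: "x = 1 \<or> x = - 1" if "A * (A - 4) * x\<^sup>2 = A * (A - 4)"
    using that A by (simp add: power2_eq_1_iff)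
  consider (same) "2 * y - A * x = - 1"
    | (up) "2 * y - A * x = A - 2" "A * x\<^sup>2 - A * x * y + y\<^sup>2 = 1"
    | (down) "2 * y - A * x = - A" "A * x\<^sup>2 - A * x * y + y\<^sup>2 = A"
    using q q' diff by auto
  then show ?thesis
  proof cases
    case same
    have "A * (A - 4) * x\<^sup>2 \<ge> 0" using A by simp
    then have "A * x\<^sup>2 - A * x * y + y\<^sup>2 < 1" using square same by simp
    then show ?thesis using q A by auto
  next
    case up
    have "A * (A - 4) * x\<^sup>2 = (A - 2)\<^sup>2 - 4"
      using square unfolding up by linarith
    also have "\<dots> = A * (A - 4)"
      by (simp add: algebra_simps power2_eq_square)
    finally have "A * (A - 4) * x\<^sup>2 = A * (A - 4)" .
    then show ?thesis using unit up(1) by (auto simp: A_def)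
  next
    case down
    have "A * (A - 4) * x\<^sup>2 = (- A)\<^sup>2 - 4 * A"
      using square unfolding down by linarith
    also have "\<dots> = A * (A - 4)"
      by (simp add: algebra_simps power2_eq_square)
    finally have "A * (A - 4) * x\<^sup>2 = A * (A - 4)" .
    then show ?thesis using unit down(1) by (auto simp: A_def)
  qed
qed

theorem theorem3p6:
  fixes a b :: nat and \<beta> :: "real \<times> real"
  assumes "a > 4" and "b = 1"
    and "\<beta> \<in> pos_real_roots a b"
  shows "(\<beta> + alpha1 \<in> real_roots a b \<longleftrightarrow> \<beta> = alpha2) \<and>
         (\<beta> - alpha1 \<in> real_roots a b \<longleftrightarrow> \<beta> = alpha1 + alpha2) \<and>
         (\<beta> + alpha2 \<in> real_roots a b \<longleftrightarrow>
            \<beta> = alpha1 \<or> \<beta> = alpha1 + (real a - 1) *\<^sub>R alpha2) \<and>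
         (\<beta> - alpha2 \<in> real_roots a b \<longleftrightarrow>
            \<beta> = alpha1 + alpha2 \<or> \<beta> = alpha1 + real a *\<^sub>R alpha2)"
proof -
  obtain x y where \<beta>: "\<beta> = (x, y)" by (cases \<beta>)
  have root: "(x, y) \<in> real_roots a 1" and pos: "x \<ge> 0" "y \<ge> 0"
    using assms by (auto simp: pos_real_roots_def \<beta>)
  have alphas: "(1, 0) \<in> real_roots a 1" "(0, 1) \<in> real_roots a 1"
    using simple_roots_in_real_roots[where b = 1] by (auto simp: alpha1_def alpha2_def)
  have sum: "(1, 1) \<in> real_roots a 1"
    using real_roots_closed[OF simple_reflections_in_weyl_group(1) alphas(2)]
    by (simp add: w1_def)
  have w2_alpha1: "(1, real a) \<in> real_roots a 1"
    using real_roots_closed[OF simple_reflections_in_weyl_group(2) alphas(1)]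
    by (simp add: w2_def)
  have w2_sum: "(1, real a - 1) \<in> real_roots a 1"
    using real_roots_closed[OF simple_reflections_in_weyl_group(2) sum]
    by (simp add: w2_def)
  have up1: "(x, y) = (0, 1)" if "(x + 1, y) \<in> real_roots a 1"
    using root_string_alpha1[OF assms(1) root] that pos by (auto simp: alpha1_def)
  have down1: "(x, y) = (1, 1)" if "(x - 1, y) \<in> real_roots a 1"
    using root_string_alpha1[OF assms(1) that] root pos by (auto simp: alpha1_def)
  have up2: "(x, y) = (1, 0) \<or> (x, y) = (1, real a - 1)" if "(x, y + 1) \<in> real_roots a 1"
    using root_string_alpha2[OF assms(1) root] that pos by (auto simp: alpha2_def)
  have down2: "(x, y) = (1, 1) \<or> (x, y) = (1, real a)" if "(x, y - 1) \<in> real_roots a 1"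
    using root_string_alpha2[OF assms(1) that] root pos by (auto simp: alpha2_def)
  show ?thesis
    using up1 down1 up2 down2 alphas sum w2_alpha1 w2_sum
    unfolding \<beta> \<open>b = 1\<close> by (auto simp: alpha1_def alpha2_def)
qed

end
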